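(* Let $(X,d)$ be a nonempty metric space, let $r\in[0,1]$ and let $U$ be a subset of $F^r_{USCG}(X)$. Then the following properties are equivalent. (i) $U$ is relatively compact in $(F_{USCG}(X), H_{\rm end})$. (ii) $U$ is relatively compact in $(F^r_{USCG}(X), H_{\rm end})$. (iii) $U(\alpha)$ is relatively compact in $(X,d)$ for each $\alpha\in(0,1]$. (iv) $U(\alpha)$ is relatively compact in $(X,d)$ for each $\alpha\in(0,r]$.
   Context: A fuzzy set in $X$ is a function $u:X\to[0,1]$. For $\alpha\in(0,1]$, $[u]_\alpha=\{x\in X: u(x)\ge\alpha\}$, and $[u]_0=\overline{\{x\in X: u(x)>0\}}$ (closure in $X$). $C(X)$ and $K(X)$ denote the sets of all nonempty closed, respectively nonempty compact, subsets of $X$. $F_{USC}(X)$ is the set of fuzzy sets $u$ in $X$ with $[u]_\alpha\in C(X)\cup\{\emptyset\}$ for all $\alpha\in[0,1]$ (the upper semicontinuous fuzzy sets), and $F_{USCG}(X)=\{u\in F_{USC}(X): [u]_\alpha\in K(X)\cup\{\emptyset\}\text{ for all }\alpha\in(0,1]\}$. For $r\in[0,1]$, $F^r_{USCG}(X)=\{u\in F_{USCG}(X): r=\max\{u(x):x\in X\}\}$ (the maximum is required to exist and equal $r$). $X\times[0,1]$ carries the metric $\overline d((x,\alpha),(y,\beta))=d(x,y)+|\alpha-\beta|$. The endograph of $u$ is ${\rm end}\,u=\{(x,t)\in X\times[0,1]: u(x)\ge t\}$; for $u\in F_{USC}(X)$ it is a nonempty closed set. For nonempty closed $A,B\subseteq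 X\times[0,1]$, $H(A,B)=\max\{\sup_{a\in A}\inf_{b\in B}\overline d(a,b),\ \sup_{b\in B}\inf_{a\in A}\overline d(a,b)\}$. The endograph metric on $F_{USC}(X)$ and its subsets is $H_{\rm end}(u,v)=H({\rm end}\,u,{\rm end}\,v)$. For a set $U$ of fuzzy sets, $U(\alpha)=\bigcup_{u\in U}[u]_\alpha$ (an empty union is $\emptyset$). A subset $A$ of a metric space $Z$ is relatively compact in $Z$ if its closure in $Z$ is compact. Convention: $(0,0]=\emptyset$. *)

theory Defs
  imports "HOL-Analysis.Analysis"
begin

definition alpha_cut :: "('a::metric_space \<Rightarrow> real) \<Rightarrow> real \<Rightarrow> 'a set" where
  "alpha_cut u \<alpha> = (if \<alpha> = 0 then closure {x. u x > 0} else {x. u x \<ge> \<alpha>})"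

(* closed and compact both admit the empty set, so they express membership in
   C(X) with {} added and in K(X) with {} added. *)

definition F_USC :: "('a::metric_space \<Rightarrow> real) set" where
  "F_USC = {u. range u \<subseteq> {0..1} \<and> (\<forall>\<alpha>\<in>{0..1}. closed (alpha_cut u \<alpha>))}"

definition F_USCG :: "('a::metric_space \<Rightarrow> real) set" where
  "F_USCG = {u \<in> F_USC. \<forall>\<alpha>\<in>{0<..1}. compact (alpha_cut u \<alpha>)}"

definition F_USCG_max :: "real \<Rightarrow> ('a::metric_space \<Rightarrow> real) set" where
  "F_USCG_max r = {u \<in> F_USCG. r \<in> range u \<and> (\<forall>x. u x \<le> r)}"

(* dist on the product type is the Euclidean combination of the component
   distances, hence a separate sum metric. *)

definition dsum :: "'a::metric_space \<times> real \<Rightarrow> 'a \<times> real \<Rightarrow> real" where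
  "dsum p q = dist (fst p) (fst q) + \<bar>snd p - snd q\<bar>"

definition endograph :: "('a::metric_space \<Rightarrow> real) \<Rightarrow> ('a \<times> real) set" where
  "endograph u = {(x, t). t \<in> {0..1} \<and> u x \<ge> t}"

(* Valued in ennreal because the Hausdorff distance of unbounded closed sets can
   be infinite; between endographs it is at most 1 (hausdorff_endograph_le_1). *)

definition hausdorff :: "('a::metric_space \<times> real) set \<Rightarrow> ('a \<times> real) set \<Rightarrow> ennreal" where
  "hausdorff A B = max (SUP a\<in>A. INF b\<in>B. ennreal (dsum a b)) (SUP b\<in>B. INF a\<in>A. ennreal (dsum a b))"

definition H_end :: "('a::metric_space \<Rightarrow> real) \<Rightarrow> ('a \<Rightarrow> real) \<Rightarrow> real" where
  "H_end u v = enn2real (hausdorff (endograph u) (endograph v))"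

definition cut_union :: "('a::metric_space \<Rightarrow> real) set \<Rightarrow> real \<Rightarrow> 'a set" where
  "cut_union U \<alpha> = (\<Union>u\<in>U. alpha_cut u \<alpha>)"

definition relatively_compact_in :: "'b topology \<Rightarrow> 'b set \<Rightarrow> bool" where
  "relatively_compact_in T S \<longleftrightarrow> S \<subseteq> topspace T \<and> compactin T (T closure_of S)"

(* Metric_space.mtopology is a topology with the intended open sets only when its
   arguments form a metric space; the rest of the theory establishes this for H_end. *)

lemma dsum_nonneg: "0 \<le> dsum p q"
  by (simp add: dsum_def)

lemma dsum_commute: "dsum p q = dsum q p"
  by (simp add: dsum_def dist_commute abs_minus_commute)

lemma dsum_triangle: "dsum p r \<le> dsum p q + dsum q r"
  using dist_triangle[of "fst p" "fst r" "fst q"] unfolding dsum_def by linarith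

lemma hausdorff_commute: "hausdorff A B = hausdorff B A"
  by (simp add: hausdorff_def dsum_commute max.commute)

lemma ennreal_const_add_INF: "(INF i\<in>I. c + f i) = c + (INF i\<in>I. f i)" for c :: ennreal
proof (cases "I = {}")
  case False
  have "continuous (at_right (Inf (f ` I))) (\<lambda>x. c + x)"
    using continuous_add[of "at_right (Inf (f ` I))" "\<lambda>x. c" "\<lambda>x. x"] by simp
  then have "c + Inf (f ` I) = (INF x\<in>f ` I. c + x)"
    using False by (intro continuous_at_Inf_mono) (auto intro!: monoI add_left_mono)
  then show ?thesis by (simp add: image_image)
qed simp

lemma SUP_INF_dsum_triangle:
  "(SUP a\<in>A. INF c\<in>C. ennreal (dsum a c))
     \<le> (SUP a\<in>A. INF b\<in>B. ennreal (dsum a b)) + (SUP b\<in>B. INF c\<in>C. ennreal (dsum b c))"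
  (is "_ \<le> ?S + ?T")
proof (rule SUP_least)
  fix a assume a: "a \<in> A"
  have "(INF c\<in>C. ennreal (dsum a c)) \<le> ennreal (dsum a b) + ?T" if b: "b \<in> B" for b
  proof -
    have "(INF c\<in>C. ennreal (dsum a c)) \<le> (INF c\<in>C. ennreal (dsum a b) + ennreal (dsum b c))"
      by (rule INF_mono)
        (metis dsum_nonneg dsum_triangle ennreal_leI ennreal_plus)
    also have "\<dots> = ennreal (dsum a b) + (INF c\<in>C. ennreal (dsum b c))"
    by (rule ennreal_const_add_INF)
    also have "\<dots> \<le> ennreal (dsum a b) + ?T"
      using b by (intro add_left_mono SUP_upper)
    finally show ?thesis .
  qed
  then have "(INF c\<in>C. ennreal (dsum a c)) \<le> (INF b\<in>B. ennreal (dsum a b) + ?T)"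
    by (rule INF_greatest)
  also have "\<dots> = (INF b\<in>B. ennreal (dsum a b)) + ?T"
  using ennreal_const_add_INF[of ?T "\<lambda>b. ennreal (dsum a b)" B] by (simp add: add.commute)
  also have "\<dots> \<le> ?S + ?T"
    using a by (intro add_right_mono SUP_upper)
  finally show "(INF c\<in>C. ennreal (dsum a c)) \<le> ?S + ?T" .
qed

lemma hausdorff_triangle: "hausdorff A C \<le> hausdorff A B + hausdorff B C"
proof -
  have 1: "(SUP a\<in>A. INF c\<in>C. ennreal (dsum a c)) \<le> hausdorff A B + hausdorff B C"
    by (rule order_trans[OF SUP_INF_dsum_triangle[where B = B]])
      (auto simp: hausdorff_def intro!: add_mono)
  have "(SUP c\<in>C. INF a\<in>A. ennreal (dsum c a)) \<le> hausdorff B C + hausdorff A B"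
    by (rule order_trans[OF SUP_INF_dsum_triangle[where B = B]])
      (auto simp: hausdorff_def dsum_commute intro!: add_mono)
  with 1 show ?thesis
    by (simp add: hausdorff_def[of A C] dsum_commute add.commute)
qed

lemma F_USC_range: "u \<in> F_USC \<Longrightarrow> u x \<in> {0..1}"
  unfolding F_USC_def by blast

lemma hausdorff_endograph_le_1:
  assumes "u \<in> F_USC" "v \<in> F_USC"
  shows "hausdorff (endograph u) (endograph v) \<le> 1"
proof -
  have *: "(INF b\<in>endograph v. ennreal (dsum a b)) \<le> 1"
    if "v \<in> F_USC" "a \<in> endograph u" for u v :: "'a \<Rightarrow> real" and a
  proof -
    have "(fst a, 0) \<in> endograph v"
      using F_USC_range[OF that(1), of "fst a"] by (simp add: endograph_def)
    then have "(INF b\<in>endograph v. ennreal (dsum a b)) \<le> ennreal (dsum a (fst a, 0))"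
      by (rule INF_lower)
    also have "\<dots> \<le> 1"
      using that by (auto simp: dsum_def endograph_def)
    finally show ?thesis .
  qed
  have "(SUP b\<in>endograph v. INF a\<in>endograph u. ennreal (dsum a b)) \<le> 1"
    using *[OF assms(1)] by (auto simp: dsum_commute intro!: SUP_least)
  then show ?thesis
    using *[OF assms(2)] by (auto simp: hausdorff_def intro!: SUP_least)
qed

lemma ennreal_H_end:
  assumes "u \<in> F_USC" "v \<in> F_USC"
  shows "ennreal (H_end u v) = hausdorff (endograph u) (endograph v)"
  using hausdorff_endograph_le_1[OF assms] unfolding H_end_def
  by (metis ennreal_enn2real ennreal_one_less_top le_less_trans)

lemma hausdorff_endograph_zero_le:
  assumes u: "u \<in> F_USC" and v: "v \<in> F_USC"
    and z: "hausdorff (endograph u) (endograph v) = 0"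
  shows "u x \<le> v x"
proof (rule dense_le)
  fix \<alpha> assume \<alpha>: "\<alpha> < u x"
  show "\<alpha> \<le> v x"
  proof (cases "\<alpha> \<le> 0")
    case True
    moreover have "0 \<le> v x" using F_USC_range[OF v] by simp
    ultimately show ?thesis by linarith
  next
    case False
    have ux: "u x \<in> {0..1}" using F_USC_range[OF u] .
    then have p: "(x, u x) \<in> endograph u" by (auto simp: endograph_def)
    have "(SUP a\<in>endograph u. INF b\<in>endograph v. ennreal (dsum a b)) = 0"
      using z unfolding hausdorff_def by (metis max.cobounded1 le_zero_eq)
    then have inf0: "(INF b\<in>endograph v. ennreal (dsum (x, u x) b)) = 0"
      using SUP_upper[OF p, of "\<lambda>a. INF b\<in>endograph v. ennreal (dsum a b)"] by simp
    have "x \<in> closure {y. v y \<ge> \<alpha>}"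
      unfolding closure_approachable
    proof (intro allI impI)
      fix e :: real assume "e > 0"
      define \<delta> where "\<delta> = min e (u x - \<alpha>)"
      have "\<delta> > 0" using \<open>e > 0\<close> \<alpha> by (simp add: \<delta>_def)
      then have "(INF b\<in>endograph v. ennreal (dsum (x, u x) b)) < ennreal \<delta>"
        using inf0 by simp
      then obtain b where b: "b \<in> endograph v" "ennreal (dsum (x, u x) b) < ennreal \<delta>"
        by (auto simp: INF_less_iff)
      obtain y s where bs: "b = (y, s)" by (cases b)
      have "dist x y + \<bar>u x - s\<bar> < \<delta>"
        using b(2) by (simp add: ennreal_less_iff[OF dsum_nonneg]) (simp add: dsum_def bs)
      moreover have "s \<le> v y" using b(1) by (simp add: endograph_def bs)
      ultimately have "v y \<ge> \<alpha>" "dist y x < e"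
        using zero_le_dist[of x y] unfolding \<delta>_def dist_commute[of y x] by linarith+
      then show "\<exists>y\<in>{y. v y \<ge> \<alpha>}. dist y x < e" by auto
    qed
    moreover have "closed (alpha_cut v \<alpha>)"
      using v False \<alpha> ux by (simp add: F_USC_def)
    then have "closed {y. v y \<ge> \<alpha>}"
      using False by (auto simp: alpha_cut_def split: if_splits)
    ultimately show ?thesis by simp
  qed
qed

lemma Metric_space_F_USC: "Metric_space (F_USC :: ('a::metric_space \<Rightarrow> real) set) H_end"
proof
  fix u v :: "'a \<Rightarrow> real"
  show "0 \<le> H_end u v" by (simp add: H_end_def)
  show "H_end u v = H_end v u" by (simp add: H_end_def hausdorff_commute)
next
  fix u v :: "'a \<Rightarrow> real" assume uv: "u \<in> F_USC" "v \<in> F_USC"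
  show "H_end u v = 0 \<longleftrightarrow> u = v"
  proof
    assume "H_end u v = 0"
    then have z: "hausdorff (endograph u) (endograph v) = 0"
      using ennreal_H_end[OF uv] by simp
    show "u = v"
    proof
      fix x
      have "hausdorff (endograph v) (endograph u) = 0"
        using z by (simp add: hausdorff_commute)
      then show "u x = v x"
        using order.antisym[OF hausdorff_endograph_zero_le[OF uv z]
          hausdorff_endograph_zero_le[OF uv(2) uv(1)]] by blast
    qed
  next
    assume "u = v"
    have "(SUP a\<in>A. INF b\<in>A. ennreal (dsum a b)) = 0" for A :: "('a \<times> real) set"
    proof -
      have "(INF b\<in>A. ennreal (dsum a b)) \<le> 0" if "a \<in> A" for a
        by (rule order_trans[OF INF_lower[OF that]]) (simp add: dsum_def)
      then have "(SUP a\<in>A. INF b\<in>A. ennreal (dsum a b)) \<le> 0"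
        by (rule SUP_least)
      then show ?thesis by simp
    qed
    then have "hausdorff A A = 0" for A :: "('a \<times> real) set"
      by (simp add: hausdorff_def dsum_commute)
    then show "H_end u v = 0"
      using \<open>u = v\<close> by (simp add: H_end_def)
  qed
next
  fix u v w :: "'a \<Rightarrow> real" assume "u \<in> F_USC" "v \<in> F_USC" "w \<in> F_USC"
  then have "ennreal (H_end u w) \<le> ennreal (H_end u v) + ennreal (H_end v w)"
    using hausdorff_triangle by (simp add: ennreal_H_end)
  then have "ennreal (H_end u w) \<le> ennreal (H_end u v + H_end v w)"
    by (simp add: H_end_def)
  moreover have "0 \<le> H_end u v + H_end v w" by (simp add: H_end_def)
  ultimately show "H_end u w \<le> H_end u v + H_end v w" by simp
qed

lemma Metric_space_F_USCG: "Metric_space F_USCG H_end"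
  by (rule Metric_space.subspace[OF Metric_space_F_USC]) (auto simp: F_USCG_def)

lemma Metric_space_F_USCG_max: "Metric_space (F_USCG_max r) H_end"
  by (rule Metric_space.subspace[OF Metric_space_F_USCG]) (auto simp: F_USCG_max_def)

end

theory Submission
  imports Defs
begin

text \<open>
  Relative compactness of a family in a metric space means that each of its sequences has a
  subsequence converging in the space. With this description the equivalence comes down to
  following points of endographs.

  If \<open>U\<close> is relatively compact for the endograph metric and \<open>x n\<close> is a sequence of points at which
  members \<open>v n\<close> of \<open>U\<close> have height at least \<open>\<alpha>\<close>, then along a subsequence \<open>v n\<close> converges to some \<open>u\<close>.
  The points \<open>(x n, \<alpha>)\<close> of their endographs come close to the endograph of \<open>u\<close>, so \<open>x n\<close> comes
  close to the cut of \<open>u\<close> at height \<open>\<alpha> / 2\<close>. That cut is compact, so \<open>x n\<close> has a convergent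
  subsequence (\<open>relatively_compact_cut_union\<close>).

  Conversely, let all the sets \<open>cut_union U \<alpha>\<close> with \<open>\<alpha> > 0\<close> be relatively compact. Parts of an endograph
  below height \<open>\<epsilon>\<close> are within \<open>\<epsilon>\<close> of the base \<open>X \<times> {0}\<close>, which all endographs contain, so
  up to an error \<open>\<epsilon>\<close> only the part over the totally bounded set \<open>cut_union U \<epsilon>\<close> matters. Covering that
  part by finitely many boxes shows that \<open>U\<close> is totally bounded
  (\<open>mtotally_bounded_if_relatively_compact_cuts\<close>), and each sequence in \<open>U\<close> has a Cauchy subsequence.
  Since \<open>X\<close> may be incomplete, a limit has to be produced by hand:
  the set of cluster points of the endographs is the endograph of a function, whose cuts are compact
  because they lie in closures of the sets \<open>cut_union U (\<alpha> / 2)\<close> (\<open>upper_limit_in_F_USCG\<close>), and the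
  Cauchy sequence converges to it (\<open>Cauchy_tendsto_upper_limit\<close>).

  The ambient spaces with and without a prescribed maximum give the same notion, because
  limits keep the supremum \<open>r\<close>, and compactness of the cuts turns the supremum into a maximum
  (\<open>F_USCG_max_closed\<close>). Finally, cuts above the height \<open>r\<close> are empty.
\<close>

section \<open>Relative compactness by sequences\<close>

lemma (in Metric_space) relatively_compact_in_iff_subsequence:
  "relatively_compact_in mtopology S \<longleftrightarrow>
     S \<subseteq> M \<and> (\<forall>\<sigma>::nat \<Rightarrow> 'a. range \<sigma> \<subseteq> S \<longrightarrow>
       (\<exists>l\<in>M. \<exists>\<rho>. strict_mono \<rho> \<and> (\<lambda>n. d (\<sigma> (\<rho> n)) l) \<longlonglongrightarrow> 0))"
proof (cases "S \<subseteq> M")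
  case True
  have lim: "limitin mtopology (\<sigma> \<circ> \<rho>) l sequentially \<longleftrightarrow>
      l \<in> M \<and> (\<lambda>n. d (\<sigma> (\<rho> n)) l) \<longlonglongrightarrow> 0"
    if "range \<sigma> \<subseteq> S" for \<sigma> :: "nat \<Rightarrow> 'a" and \<rho> l
  proof -
    have "\<sigma> (\<rho> n) \<in> M" for n using that True by blast
    then show ?thesis by (simp add: limitin_metric_dist_null o_def)
  qed
  have "compactin mtopology (mtopology closure_of S) \<longleftrightarrow>
      (\<forall>T. T \<subseteq> S \<and> infinite T \<longrightarrow> M \<inter> mtopology derived_set_of T \<noteq> {})"
    using True derived_set_of_subset_topspace[of mtopology]
    by (auto simp: compact_closure_of_eq_Bolzano_Weierstrass Int_absorb1 subset_trans)
  also have "\<dots> \<longleftrightarrow> (\<forall>\<sigma>::nat \<Rightarrow> 'a. range \<sigma> \<subseteq> S \<longrightarrow>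
       (\<exists>l \<rho>. l \<in> M \<and> strict_mono \<rho> \<and> limitin mtopology (\<sigma> \<circ> \<rho>) l sequentially))"
    by (rule Bolzano_Weierstrass_property[OF True True, symmetric])
  also have "\<dots> \<longleftrightarrow> (\<forall>\<sigma>::nat \<Rightarrow> 'a. range \<sigma> \<subseteq> S \<longrightarrow>
       (\<exists>l\<in>M. \<exists>\<rho>. strict_mono \<rho> \<and> (\<lambda>n. d (\<sigma> (\<rho> n)) l) \<longlonglongrightarrow> 0))"
    using lim by (intro all_cong1 imp_cong refl) blast
  finally show ?thesis
    using True by (simp add: relatively_compact_in_def)
qed (auto simp: relatively_compact_in_def)

lemma relatively_compact_in_euclidean_iff_subsequence:
  fixes S :: "'a::metric_space set"
  shows "relatively_compact_in euclidean S \<longleftrightarrow>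
    (\<forall>\<sigma>::nat \<Rightarrow> 'a. range \<sigma> \<subseteq> S \<longrightarrow> (\<exists>l \<rho>. strict_mono \<rho> \<and> (\<sigma> \<circ> \<rho>) \<longlonglongrightarrow> l))"
  using Met_TC.relatively_compact_in_iff_subsequence[of S]
  by (simp add: tendsto_dist_iff[symmetric] o_def flip: tendsto_dist_iff)

lemma relatively_compact_in_euclidean_iff_compact_closure:
  "relatively_compact_in euclidean S \<longleftrightarrow> compact (closure S)"
  by (simp add: relatively_compact_in_def)

section \<open>The endograph metric in terms of function values\<close>

text \<open>
  The next two lemmas replace the Hausdorff distance of endographs by statements about values only.
  It suffices to approximate the top point \<open>(x, u x)\<close> above each \<open>x\<close>, since an approximation
  of it can be lowered along with it, and points of height at most \<open>e\<close> are already within \<open>e\<close> of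
  the base of the other endograph. The factor 2 adds the horizontal and the vertical error.
\<close>

lemma H_end_leI:
  assumes u: "u \<in> F_USC" and v: "v \<in> F_USC" and e: "0 \<le> e"
    and uv: "\<And>x. e < u x \<Longrightarrow> \<exists>y. dist x y \<le> e \<and> u x - e \<le> v y"
    and vu: "\<And>x. e < v x \<Longrightarrow> \<exists>y. dist x y \<le> e \<and> v x - e \<le> u y"
  shows "H_end u v \<le> 2 * e"
proof -
  have one_sided: "(SUP p\<in>endograph u. INF q\<in>endograph v. ennreal (dsum p q)) \<le> ennreal (2 * e)"
    if v: "v \<in> F_USC"
      and uv: "\<And>x. e < u x \<Longrightarrow> \<exists>y. dist x y \<le> e \<and> u x - e \<le> v y"
    for u v :: "'a \<Rightarrow> real"
  proof (rule SUP_least)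
    fix p assume "p \<in> endograph u"
    then obtain x t where p: "p = (x, t)" "0 \<le> t" "t \<le> 1" "t \<le> u x"
      by (auto simp: endograph_def)
    have "\<exists>q\<in>endograph v. dsum p q \<le> 2 * e"
    proof (cases "e < t")
      case True
      then obtain y where y: "dist x y \<le> e" "u x - e \<le> v y"
        using uv[of x] p by force
      have "(y, t - e) \<in> endograph v"
        using y p True e by (auto simp: endograph_def)
      moreover have "dsum p (y, t - e) \<le> 2 * e"
        using y e by (simp add: p dsum_def)
      ultimately show ?thesis by blast
    next
      case False
      have "(x, 0) \<in> endograph v"
        using F_USC_range[OF v, of x] by (simp add: endograph_def)
      moreover have "dsum p (x, 0) \<le> 2 * e"
        using False p e by (simp add: dsum_def)
      ultimately show ?thesis by blast
    qed
    then show "(INF q\<in>endograph v. ennreal (dsum p q)) \<le> ennreal (2 * e)"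
      by (meson INF_lower2 ennreal_leI)
  qed
  have "(SUP p\<in>endograph u. INF q\<in>endograph v. ennreal (dsum p q)) \<le> ennreal (2 * e)"
    using v uv by (rule one_sided)
  moreover have "(SUP p\<in>endograph v. INF q\<in>endograph u. ennreal (dsum p q)) \<le> ennreal (2 * e)"
    using u vu by (rule one_sided)
  ultimately have "hausdorff (endograph u) (endograph v) \<le> ennreal (2 * e)"
    by (simp add: hausdorff_def dsum_commute)
  then show ?thesis
    using ennreal_H_end[OF u v] e by (metis ennreal_le_iff mult_nonneg_nonneg zero_le_numeral)
qed

lemma H_end_lessD:
  assumes u: "u \<in> F_USC" and v: "v \<in> F_USC" and less: "H_end u v < e"
  obtains y where "dist x y < e" "u x - e < v y"
proof -
  have e: "0 < e"
    using less by (metis H_end_def enn2real_nonneg le_less_trans)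
  have p: "(x, u x) \<in> endograph u"
    using F_USC_range[OF u, of x] by (auto simp: endograph_def)
  have "(INF q\<in>endograph v. ennreal (dsum (x, u x) q)) \<le> hausdorff (endograph u) (endograph v)"
    unfolding hausdorff_def by (rule max.coboundedI1) (rule SUP_upper[OF p])
  also have "\<dots> < ennreal e"
    using less e by (simp add: ennreal_H_end[OF u v, symmetric] ennreal_lessI)
  finally obtain q where q: "q \<in> endograph v" "ennreal (dsum (x, u x) q) < ennreal e"
    by (auto simp: INF_less_iff)
  then have "dsum (x, u x) q < e"
    by (simp add: ennreal_less_iff dsum_nonneg)
  moreover obtain y s where "q = (y, s)" by (cases q)
  ultimately have "dist x y + \<bar>u x - s\<bar> < e" "s \<le> v y"
    using q(1) by (auto simp: dsum_def endograph_def)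
  then show ?thesis
    using that[of y] zero_le_dist[of x y] by linarith
qed

lemma H_end_commute: "H_end u v = H_end v u"
  by (simp add: H_end_def hausdorff_commute)

lemma H_end_nonneg: "0 \<le> H_end u v"
  by (simp add: H_end_def)

lemma F_USCG_max_subset: "F_USCG_max r \<subseteq> F_USCG" and F_USCG_subset: "F_USCG \<subseteq> F_USC"
  by (auto simp: F_USCG_max_def F_USCG_def)

section \<open>Convergence preserves the maximum\<close>

text \<open>
  Semicontinuity and compact cuts force the supremum to be attained: the cuts at the heights
  \<open>c < r\<close> are nonempty, nested and compact, and a common point of them has value \<open>r\<close>. For \<open>r = 0\<close> there
  are no such cuts, but then the function vanishes identically.
\<close>
lemma F_USCG_attains_bound:
  fixes u :: "'a::metric_space \<Rightarrow> real"
  assumes u: "u \<in> F_USCG" and r: "r \<in> {0..1}" and le: "\<And>x. u x \<le> r"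
    and approx: "\<And>e. 0 < e \<Longrightarrow> \<exists>x. r - e < u x"
  shows "r \<in> range u"
proof (cases "r = 0")
  case True
  then have "u undefined = r"
    using le[of undefined] F_USC_range[of u undefined] u by (auto simp: F_USCG_def)
  then show ?thesis by blast
next
  case False
  let ?C = "\<lambda>c. {x. c \<le> u x}"
  have r0: "0 < r" using False r by simp
  have compact: "compact (?C c)" if "c \<in> {0<..<r}" for c
  proof -
    have "c \<in> {0<..1}" using that r by auto
    then have "compact (alpha_cut u c)" using u by (auto simp: F_USCG_def)
    then show ?thesis using that by (simp add: alpha_cut_def)
  qed
  have "?C (r / 2) \<inter> (\<Inter>c\<in>{0<..<r}. ?C c) \<noteq> {}"
  proof (rule compact_imp_fip_image)
    show "compact (?C (r / 2))" using compact[of "r / 2"] r0 by simp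
    show "closed (?C c)" if "c \<in> {0<..<r}" for c using compact[OF that] by (rule compact_imp_closed)
    fix I assume I: "finite I" "I \<subseteq> {0<..<r}"
    \<comment> \<open>The cuts are nested, so the highest of finitely many is their intersection.\<close>
    define m where "m = Max (insert (r / 2) I)"
    have "m < r" using I r0 by (auto simp: m_def)
    then obtain x where x: "m < u x" using approx[of "r - m"] by auto
    have "c \<le> u x" if "c \<in> insert (r / 2) I" for c
    proof -
      have "c \<le> m" unfolding m_def using I(1) that by (intro Max_ge) auto
      then show ?thesis using x by linarith
    qed
    then have "x \<in> ?C (r / 2) \<inter> (\<Inter>c\<in>I. ?C c)" by blast
    then show "?C (r / 2) \<inter> (\<Inter>c\<in>I. ?C c) \<noteq> {}" by blast
  qed
  then obtain x where x: "\<forall>c\<in>{0<..<r}. c \<le> u x" by blast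
  have "r \<le> u x" by (rule dense_le_bounded[OF r0]) (use x in auto)
  then have "u x = r" using le[of x] by simp
  then show ?thesis by blast
qed

text \<open>
  Fuzzy sets at distance less than \<open>e\<close> have suprema that differ by at most \<open>e\<close>, so the limit has
  supremum \<open>r\<close>.
\<close>
lemma F_USCG_max_closed:
  fixes u :: "'a::metric_space \<Rightarrow> real"
  assumes u: "u \<in> F_USCG" and r: "r \<in> {0..1}" and \<sigma>: "\<And>n. \<sigma> n \<in> F_USCG_max r"
    and lim: "(\<lambda>n. H_end (\<sigma> n) u) \<longlonglongrightarrow> 0"
  shows "u \<in> F_USCG_max r"
proof -
  have USC: "u \<in> F_USC" "\<sigma> n \<in> F_USC" for n
    using u \<sigma>[of n] F_USCG_subset F_USCG_max_subset by blast+
  have close: "\<exists>n. H_end (\<sigma> n) u < e" if "0 < e" for e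
    using order_tendstoD(2)[OF lim that] eventually_happens'[OF sequentially_bot] by blast
  have "u x \<le> r" for x
  proof (rule ccontr)
    assume "\<not> u x \<le> r"
    then obtain n where "H_end u (\<sigma> n) < u x - r"
      using close[of "u x - r"] by (auto simp: H_end_commute)
    then obtain y where "r < \<sigma> n y"
      using H_end_lessD[OF USC] by (metis diff_diff_eq2 add_diff_cancel_left')
    then show False using \<sigma>[of n] by (auto simp: F_USCG_max_def not_less[symmetric])
  qed
  moreover have "\<exists>x. r - e < u x" if "0 < e" for e
  proof -
    obtain n where n: "H_end (\<sigma> n) u < e" using close \<open>0 < e\<close> by blast
    obtain x where "\<sigma> n x = r" using \<sigma>[of n] by (auto simp: F_USCG_max_def)
    then show ?thesis using H_end_lessD[OF USC(2,1) n, of x] by metis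
  qed
  ultimately show ?thesis
    using F_USCG_attains_bound[OF u r] u by (auto simp: F_USCG_max_def)
qed

section \<open>Relatively compact families have relatively compact cuts\<close>

text \<open>
  Points of height at least \<open>\<alpha>\<close> in a sequence converging to \<open>u\<close> are shadowed by points of
  the cut of \<open>u\<close> at height \<open>\<alpha> / 2\<close>. Halving the height leaves room for the vertical error, and the
  shadowing points have a convergent subsequence because that cut is compact.
\<close>
lemma relatively_compact_cut_union:
  fixes U :: "('a::metric_space \<Rightarrow> real) set"
  assumes U: "relatively_compact_in (Metric_space.mtopology F_USCG H_end) U"
    and \<alpha>: "\<alpha> \<in> {0<..1}"
  shows "relatively_compact_in euclidean (cut_union U \<alpha>)"
  unfolding relatively_compact_in_euclidean_iff_subsequence
proof (intro allI impI)
  fix x :: "nat \<Rightarrow> 'a" assume "range x \<subseteq> cut_union U \<alpha>"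
  then have "\<forall>n. \<exists>v\<in>U. \<alpha> \<le> v (x n)"
    using \<alpha> by (force simp: cut_union_def alpha_cut_def)
  then obtain v where v: "\<And>n. v n \<in> U" "\<And>n. \<alpha> \<le> v n (x n)" by metis
  then have "range v \<subseteq> U" by auto
  with U obtain u \<rho> where u: "u \<in> F_USCG" "strict_mono \<rho>"
      and lim: "(\<lambda>n. H_end (v (\<rho> n)) u) \<longlonglongrightarrow> 0"
    unfolding Metric_space.relatively_compact_in_iff_subsequence[OF Metric_space_F_USCG] by metis
  have "U \<subseteq> F_USCG"
    using U Metric_space.relatively_compact_in_iff_subsequence[OF Metric_space_F_USCG] by blast
  then have USC: "u \<in> F_USC" "v n \<in> F_USC" for n
    using u v(1)[of n] F_USCG_subset by blast+
  \<comment> \<open>The distance need not be attained by points of the endographs, hence the extra summand.\<close>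
  define e where "e n = H_end (v (\<rho> n)) u + inverse (real (Suc n))" for n
  have e0: "e \<longlonglongrightarrow> 0"
    unfolding e_def using tendsto_add[OF lim LIMSEQ_inverse_real_of_nat] by simp
  have "\<exists>y. dist (x (\<rho> n)) y < e n \<and> \<alpha> - e n < u y" for n
  proof -
    have "H_end (v (\<rho> n)) u < e n" by (simp add: e_def)
    then obtain y where "dist (x (\<rho> n)) y < e n" "v (\<rho> n) (x (\<rho> n)) - e n < u y"
      by (rule H_end_lessD[OF USC(2,1)])
    then show ?thesis using v(2)[of "\<rho> n"] by force
  qed
  then obtain y where y: "\<And>n. dist (x (\<rho> n)) (y n) < e n" "\<And>n. \<alpha> - e n < u (y n)" by metis
  obtain N where N: "\<And>n. N \<le> n \<Longrightarrow> e n < \<alpha> / 2"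
    using order_tendstoD(2)[OF e0, of "\<alpha> / 2"] \<alpha> by (auto simp: eventually_sequentially)
  have "compact (alpha_cut u (\<alpha> / 2))"
    using u(1) \<alpha> by (auto simp: F_USCG_def)
  then have "seq_compact {z. \<alpha> / 2 \<le> u z}"
    using \<alpha> by (simp add: alpha_cut_def compact_eq_seq_compact_metric)
  moreover have "\<forall>n. y (n + N) \<in> {z. \<alpha> / 2 \<le> u z}"
  proof
    fix n show "y (n + N) \<in> {z. \<alpha> / 2 \<le> u z}"
      using N[of "n + N"] y(2)[of "n + N"] by simp
  qed
  ultimately obtain l \<tau> where \<tau>: "strict_mono \<tau>" "((\<lambda>n. y (n + N)) \<circ> \<tau>) \<longlonglongrightarrow> l"
    using seq_compactE[of "{z. \<alpha> / 2 \<le> u z}" "\<lambda>n. y (n + N)"] by metis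
  define \<pi> where "\<pi> n = \<tau> n + N" for n
  have \<pi>: "strict_mono \<pi>" using \<tau>(1) by (simp add: \<pi>_def strict_mono_def)
  have "(\<lambda>n. e (\<pi> n)) \<longlonglongrightarrow> 0"
    using LIMSEQ_subseq_LIMSEQ[OF e0 \<pi>] by (simp add: o_def)
  moreover have "(\<lambda>n. dist (y (\<pi> n)) l) \<longlonglongrightarrow> 0"
    using \<tau>(2) by (simp add: \<pi>_def o_def flip: tendsto_dist_iff)
  ultimately have "(\<lambda>n. e (\<pi> n) + dist (y (\<pi> n)) l) \<longlonglongrightarrow> 0"
    using tendsto_add by fastforce
  then have "(\<lambda>n. dist (x (\<rho> (\<pi> n))) l) \<longlonglongrightarrow> 0"
  proof (rule Lim_null_comparison[rotated])
    show "\<forall>\<^sub>F n in sequentially. norm (dist (x (\<rho> (\<pi> n))) l) \<le> e (\<pi> n) + dist (y (\<pi> n)) l"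
    proof (rule always_eventually, rule allI)
      fix n
      show "norm (dist (x (\<rho> (\<pi> n))) l) \<le> e (\<pi> n) + dist (y (\<pi> n)) l"
        using dist_triangle[of "x (\<rho> (\<pi> n))" l "y (\<pi> n)"] y(1)[of "\<pi> n"] by simp
    qed
  qed
  then have "(x \<circ> (\<rho> \<circ> \<pi>)) \<longlonglongrightarrow> l"
    by (simp add: o_def flip: tendsto_dist_iff)
  then show "\<exists>l \<rho>. strict_mono \<rho> \<and> (x \<circ> \<rho>) \<longlonglongrightarrow> l"
    using strict_mono_o[OF u(2) \<pi>] by blast
qed

section \<open>Families with relatively compact cuts are totally bounded\<close>

text \<open>
  Choosing one element for each of the finitely many values of \<open>\<phi>\<close> gives a finite net inside
  \<open>S\<close> itself; no approximating elements outside \<open>S\<close> have to be constructed.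
\<close>
lemma (in Metric_space) mtotally_bounded_if_finite_signature:
  assumes S: "S \<subseteq> M"
    and sig: "\<And>e. 0 < e \<Longrightarrow> \<exists>\<phi>::'a \<Rightarrow> 'b. finite (\<phi> ` S) \<and>
      (\<forall>x\<in>S. \<forall>y\<in>S. \<phi> x = \<phi> y \<longrightarrow> d x y < e)"
  shows "mtotally_bounded S"
  unfolding mtotally_bounded_def
proof (intro allI impI)
  fix e :: real assume "0 < e"
  then obtain \<phi> :: "'a \<Rightarrow> 'b" where fin: "finite (\<phi> ` S)"
    and \<phi>: "\<And>x y. x \<in> S \<Longrightarrow> y \<in> S \<Longrightarrow> \<phi> x = \<phi> y \<Longrightarrow> d x y < e"
    using sig by metis
  define K where "K = inv_into S \<phi> ` \<phi> ` S"
  have K: "K \<subseteq> S" by (auto simp: K_def inv_into_into)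
  have "S \<subseteq> (\<Union>x\<in>K. mball x e)"
  proof
    fix x assume x: "x \<in> S"
    let ?y = "inv_into S \<phi> (\<phi> x)"
    have "?y \<in> S" "\<phi> ?y = \<phi> x" using x by (auto simp: inv_into_into f_inv_into_f)
    then have "x \<in> mball ?y e" using x S \<phi> by auto
    then show "x \<in> (\<Union>x\<in>K. mball x e)" using x by (auto simp: K_def)
  qed
  moreover have "finite K" using fin by (simp add: K_def)
  ultimately show "\<exists>K. finite K \<and> K \<subseteq> S \<and> S \<subseteq> (\<Union>x\<in>K. mball x e)"
    using K by blast
qed

text \<open>
  The signature of \<open>u\<close> records which of finitely many boxes, placed over a finite \<open>\<epsilon>\<close>-net of
  \<open>cut_union U \<epsilon>\<close> and of height \<open>\<epsilon>\<close>, are met by the endograph of \<open>u\<close>. Two functions meeting the same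
  boxes have endographs that are close to each other above height \<open>2 * \<epsilon>\<close>.
\<close>
lemma mtotally_bounded_if_relatively_compact_cuts:
  fixes U :: "('a::metric_space \<Rightarrow> real) set"
  assumes U: "U \<subseteq> F_USCG"
    and cuts: "\<forall>\<alpha>\<in>{0<..1}. relatively_compact_in euclidean (cut_union U \<alpha>)"
  shows "Metric_space.mtotally_bounded F_USCG H_end U"
proof (rule Metric_space.mtotally_bounded_if_finite_signature[OF Metric_space_F_USCG U])
  fix e :: real assume "0 < e"
  define \<epsilon> where "\<epsilon> = min 1 (e / 5)"
  have \<epsilon>: "0 < \<epsilon>" "\<epsilon> \<le> 1" "4 * \<epsilon> < e" using \<open>0 < e\<close> by (auto simp: \<epsilon>_def)
  have "compact (closure (cut_union U \<epsilon>))"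
    using cuts \<epsilon> by (simp add: relatively_compact_in_euclidean_iff_compact_closure)
  then obtain N where N: "finite N" "closure (cut_union U \<epsilon>) \<subseteq> (\<Union>a\<in>N. ball a \<epsilon>)"
    using \<epsilon>(1) unfolding compact_eq_totally_bounded by blast
  define \<phi> :: "('a \<Rightarrow> real) \<Rightarrow> ('a \<times> int) set"
    where "\<phi> u = {(a, k). a \<in> N \<and> k \<in> {0..\<lfloor>1 / \<epsilon>\<rfloor>} \<and> (\<exists>y. dist a y < \<epsilon> \<and> k * \<epsilon> \<le> u y)}" for u
  have "\<phi> ` U \<subseteq> Pow (N \<times> {0..\<lfloor>1 / \<epsilon>\<rfloor>})" by (auto simp: \<phi>_def)
  then have "finite (\<phi> ` U)" using N(1) by (meson finite_Pow_iff finite_SigmaI finite_atLeastAtMost_int finite_subset)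
  moreover have "H_end u v < e" if "u \<in> U" "v \<in> U" "\<phi> u = \<phi> v" for u v
  proof -
    have half: "\<exists>y. dist x y \<le> 2 * \<epsilon> \<and> u x - 2 * \<epsilon> \<le> v y"
      if uU: "u \<in> U" and eq: "\<phi> u = \<phi> v" and x: "2 * \<epsilon> < u x" for u v x
    proof -
      have "x \<in> cut_union U \<epsilon>" using uU x \<epsilon> by (auto simp: cut_union_def alpha_cut_def intro!: bexI[of _ u])
      then obtain a where a: "a \<in> N" "dist a x < \<epsilon>"
        using N(2) closure_subset[of "cut_union U \<epsilon>"] by fastforce
      define k where "k = \<lfloor>u x / \<epsilon>\<rfloor>"
      have "u x \<in> {0..1}" using uU U F_USCG_subset F_USC_range by blast
      then have "k \<in> {0..\<lfloor>1 / \<epsilon>\<rfloor>}"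
        using \<epsilon>(1) by (auto simp: k_def intro!: floor_mono divide_right_mono)
      moreover have k: "k * \<epsilon> \<le> u x" "u x < (k + 1) * \<epsilon>"
        using floor_divide_lower[OF \<epsilon>(1), of "u x"] floor_divide_upper[OF \<epsilon>(1), of "u x"]
        unfolding k_def by simp_all
      ultimately have "(a, k) \<in> \<phi> u" using a by (auto simp: \<phi>_def)
      then have "(a, k) \<in> \<phi> v" using eq by simp
      then obtain y where y: "dist a y < \<epsilon>" "k * \<epsilon> \<le> v y" by (auto simp: \<phi>_def)
      have "dist x y \<le> 2 * \<epsilon>"
        using dist_triangle3[of x y a] a(2) y(1) by simp
      moreover have "u x - 2 * \<epsilon> \<le> v y" using k(2) y(2) \<epsilon>(1) by (simp add: algebra_simps)
      ultimately show ?thesis by blast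
    qed
    have "u \<in> F_USC" "v \<in> F_USC" using that U F_USCG_subset by blast+
    then have "H_end u v \<le> 2 * (2 * \<epsilon>)"
      using half[OF that(1,3)] half[OF that(2) that(3)[symmetric]] \<epsilon>(1) by (intro H_end_leI) auto
    then show ?thesis using \<epsilon> by simp
  qed
  ultimately show "\<exists>\<phi>::_ \<Rightarrow> ('a \<times> int) set. finite (\<phi> ` U) \<and> (\<forall>u\<in>U. \<forall>v\<in>U. \<phi> u = \<phi> v \<longrightarrow> H_end u v < e)"
    by blast
qed

section \<open>Cauchy sequences with relatively compact cuts converge\<close>

text \<open>
  For \<open>t \<in> {0..1}\<close> and \<open>\<sigma> n\<close> with values in \<open>{0..1}\<close> this says that \<open>(x, t)\<close> is a cluster point of the
  endographs of \<open>\<sigma> n\<close>, that is, lies in their Kuratowski upper limit. The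
  condition on heights is one-sided because endographs are closed under lowering points.
\<close>
definition cluster_level :: "(nat \<Rightarrow> 'a::metric_space \<Rightarrow> real) \<Rightarrow> 'a \<Rightarrow> real \<Rightarrow> bool" where
  "cluster_level \<sigma> x t \<longleftrightarrow> (\<forall>e>0. \<forall>N. \<exists>n\<ge>N. \<exists>y. dist x y < e \<and> t - e < \<sigma> n y)"

definition upper_limit :: "(nat \<Rightarrow> 'a::metric_space \<Rightarrow> real) \<Rightarrow> 'a \<Rightarrow> real" where
  "upper_limit \<sigma> x = Sup {t \<in> {0..1}. cluster_level \<sigma> x t}"

lemma cluster_level_mono: "cluster_level \<sigma> x t \<Longrightarrow> s \<le> t \<Longrightarrow> cluster_level \<sigma> x s"
  unfolding cluster_level_def by (meson diff_right_mono le_less_trans)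

text \<open>
  Upper limits of sets are closed. Applied with \<open>x' = x\<close> this shows that the supremum in
  \<open>upper_limit\<close> is attained, and applied with \<open>t' = t\<close> that the cuts of \<open>upper_limit\<close> are closed.
\<close>
lemma cluster_level_closed:
  assumes "\<And>\<delta>. 0 < \<delta> \<Longrightarrow> \<exists>x' t'. dist x x' < \<delta> \<and> t - \<delta> < t' \<and> cluster_level \<sigma> x' t'"
  shows "cluster_level \<sigma> x t"
  unfolding cluster_level_def
proof (intro allI impI)
  fix e :: real and N assume "0 < e"
  then obtain x' t' where *: "dist x x' < e / 2" "t - e / 2 < t'" "cluster_level \<sigma> x' t'"
    using assms[of "e / 2"] by auto
  then obtain n y where n: "n \<ge> N" "dist x' y < e / 2" "t' - e / 2 < \<sigma> n y"
    using \<open>0 < e\<close> unfolding cluster_level_def by (meson half_gt_zero)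
  moreover have "dist x y < e" using dist_triangle[of x y x'] * n by simp
  moreover have "t - e < \<sigma> n y" using * n by simp
  ultimately show "\<exists>n\<ge>N. \<exists>y. dist x y < e \<and> t - e < \<sigma> n y" by blast
qed

lemma
  assumes nonneg: "\<And>n x. 0 \<le> \<sigma> n x"
  shows upper_limit_range: "upper_limit \<sigma> x \<in> {0..1}"
    and le_upper_limit_iff: "t \<in> {0..1} \<Longrightarrow> t \<le> upper_limit \<sigma> x \<longleftrightarrow> cluster_level \<sigma> x t"
proof -
  let ?L = "{t \<in> {0..1}. cluster_level \<sigma> x t}"
  have "cluster_level \<sigma> x 0"
    unfolding cluster_level_def
    by (metis diff_0 dist_self le_refl neg_less_0_iff_less less_le_trans nonneg)
  then have zero: "0 \<in> ?L" by simp
  have bdd: "bdd_above ?L" by (rule bdd_aboveI[of _ 1]) auto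
  show range: "upper_limit \<sigma> x \<in> {0..1}"
    unfolding upper_limit_def using zero bdd by (auto intro!: cSup_upper cSup_least)
  have attained: "cluster_level \<sigma> x (upper_limit \<sigma> x)"
  proof (rule cluster_level_closed)
    fix \<delta> :: real assume "0 < \<delta>"
    then have "upper_limit \<sigma> x - \<delta> < Sup ?L" by (simp add: upper_limit_def)
    then obtain t where "t \<in> ?L" "upper_limit \<sigma> x - \<delta> < t"
      using zero less_cSup_iff[OF _ bdd] by blast
    then show "\<exists>x' t'. dist x x' < \<delta> \<and> upper_limit \<sigma> x - \<delta> < t' \<and> cluster_level \<sigma> x' t'"
      using \<open>0 < \<delta>\<close> by (intro exI[of _ x] exI[of _ t]) auto
  qed
  show "t \<le> upper_limit \<sigma> x \<longleftrightarrow> cluster_level \<sigma> x t" if "t \<in> {0..1}"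
  proof
    show "t \<le> upper_limit \<sigma> x \<Longrightarrow> cluster_level \<sigma> x t"
      using cluster_level_mono[OF attained] by blast
    show "cluster_level \<sigma> x t \<Longrightarrow> t \<le> upper_limit \<sigma> x"
      unfolding upper_limit_def using that bdd by (auto intro: cSup_upper)
  qed
qed

text \<open>
  A point of the cut at height \<open>\<alpha>\<close> is a limit of points where some \<open>\<sigma> n\<close> exceeds \<open>\<alpha> / 2\<close>, so the
  cut is a closed subset of the compact set \<open>closure (cut_union U (\<alpha> / 2))\<close>. This is where the
  hypothesis replaces completeness of \<open>X\<close>.
\<close>
lemma upper_limit_in_F_USCG:
  fixes U :: "('a::metric_space \<Rightarrow> real) set"
  assumes U: "U \<subseteq> F_USCG"
    and cuts: "\<forall>\<alpha>\<in>{0<..1}. relatively_compact_in euclidean (cut_union U \<alpha>)"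
    and \<sigma>: "\<And>n. \<sigma> n \<in> U"
  shows "upper_limit \<sigma> \<in> F_USCG"
proof -
  have nonneg: "0 \<le> \<sigma> n x" for n x
    using F_USC_range[of "\<sigma> n" x] \<sigma>[of n] U F_USCG_subset by auto
  note range = upper_limit_range[of \<sigma>, OF nonneg] and level = le_upper_limit_iff[of \<sigma>, OF nonneg]
  have cut: "alpha_cut (upper_limit \<sigma>) \<alpha> = {x. cluster_level \<sigma> x \<alpha>}" if "\<alpha> \<in> {0<..1}" for \<alpha>
    using that level[of \<alpha>] by (auto simp: alpha_cut_def)
  have closed: "closed (alpha_cut (upper_limit \<sigma>) \<alpha>)" if \<alpha>: "\<alpha> \<in> {0<..1}" for \<alpha>
  proof -
    have "cluster_level \<sigma> x \<alpha>" if "x \<in> closure {x. cluster_level \<sigma> x \<alpha>}" for x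
    proof (rule cluster_level_closed)
      fix \<delta> :: real assume "0 < \<delta>"
      then obtain x' where "cluster_level \<sigma> x' \<alpha>" "dist x' x < \<delta>"
        using \<open>x \<in> closure _\<close> by (auto simp: closure_approachable)
      then show "\<exists>x' t'. dist x x' < \<delta> \<and> \<alpha> - \<delta> < t' \<and> cluster_level \<sigma> x' t'"
        using \<open>0 < \<delta>\<close> by (intro exI[of _ x'] exI[of _ \<alpha>]) (auto simp: dist_commute)
    qed
    then show ?thesis unfolding cut[OF \<alpha>] using closure_subset_eq by blast
  qed
  have compact: "compact (alpha_cut (upper_limit \<sigma>) \<alpha>)" if \<alpha>: "\<alpha> \<in> {0<..1}" for \<alpha>
  proof -
    have "alpha_cut (upper_limit \<sigma>) \<alpha> \<subseteq> closure (cut_union U (\<alpha> / 2))"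
    proof
      fix x assume "x \<in> alpha_cut (upper_limit \<sigma>) \<alpha>"
      then have x: "cluster_level \<sigma> x \<alpha>" using cut[OF \<alpha>] by simp
      show "x \<in> closure (cut_union U (\<alpha> / 2))"
        unfolding closure_approachable
      proof (intro allI impI)
        fix e :: real assume "0 < e"
        define \<delta> where "\<delta> = min e (\<alpha> / 2)"
        have "0 < \<delta>" using \<open>0 < e\<close> \<alpha> by (simp add: \<delta>_def)
        then obtain n y where "dist x y < \<delta>" "\<alpha> - \<delta> < \<sigma> n y"
          using x unfolding cluster_level_def by blast
        then have "dist y x < e" "\<alpha> / 2 < \<sigma> n y" unfolding \<delta>_def by (auto simp: dist_commute)
        moreover have "y \<in> cut_union U (\<alpha> / 2)"
          using \<sigma>[of n] \<open>\<alpha> / 2 < \<sigma> n y\<close> \<alpha> by (auto simp: cut_union_def alpha_cut_def intro!: bexI[of _ "\<sigma> n"])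
        ultimately show "\<exists>y\<in>cut_union U (\<alpha> / 2). dist y x < e" by blast
      qed
    qed
    moreover have "compact (closure (cut_union U (\<alpha> / 2)))"
      using cuts \<alpha> by (simp add: relatively_compact_in_euclidean_iff_compact_closure)
    ultimately show ?thesis using closed[OF \<alpha>] compact_Int_closed by (metis inf.absorb_iff2)
  qed
  have "closed (alpha_cut (upper_limit \<sigma>) \<alpha>)" if "\<alpha> \<in> {0..1}" for \<alpha>
    using that closed[of \<alpha>] by (cases "\<alpha> = 0") (auto simp: alpha_cut_def)
  then show ?thesis using compact range by (auto simp: F_USCG_def F_USC_def)
qed

text \<open>
  A high point of \<open>\<sigma> n\<close> is shadowed by points of all later members; these lie in a relatively compact
  set and therefore accumulate at a point of the endograph of the upper limit.
  In the other direction a point of that endograph is close to the endograph of some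
  late \<open>\<sigma> m\<close>, which is uniformly close to that of \<open>\<sigma> n\<close>.
\<close>
lemma Cauchy_tendsto_upper_limit:
  fixes U :: "('a::metric_space \<Rightarrow> real) set"
  assumes U: "U \<subseteq> F_USCG"
    and cuts: "\<forall>\<alpha>\<in>{0<..1}. relatively_compact_in euclidean (cut_union U \<alpha>)"
    and \<sigma>: "\<And>n. \<sigma> n \<in> U"
    and Cauchy: "Metric_space.MCauchy F_USCG H_end \<sigma>"
  shows "(\<lambda>n. H_end (\<sigma> n) (upper_limit \<sigma>)) \<longlonglongrightarrow> 0"
proof (rule LIMSEQ_I)
  fix \<epsilon> :: real assume "0 < \<epsilon>"
  define e where "e = min 1 (\<epsilon> / 5)"
  have e: "0 < e" "e \<le> 1" "4 * e < \<epsilon>" using \<open>0 < \<epsilon>\<close> by (auto simp: e_def)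
  have USC: "\<sigma> n \<in> F_USC" "upper_limit \<sigma> \<in> F_USC" for n
    using subsetD[OF F_USCG_subset subsetD[OF U \<sigma>]]
      subsetD[OF F_USCG_subset upper_limit_in_F_USCG[OF U cuts \<sigma>]] .
  have bounds: "\<sigma> n x \<in> {0..1}" for n x using F_USC_range[OF USC(1)] .
  then have nonneg: "0 \<le> \<sigma> n x" for n x by force
  note range = upper_limit_range[of \<sigma>, OF nonneg] and level = le_upper_limit_iff[of \<sigma>, OF nonneg]
  obtain N where N: "\<And>m n. N \<le> m \<Longrightarrow> N \<le> n \<Longrightarrow> H_end (\<sigma> m) (\<sigma> n) < e"
    using Cauchy e(1) unfolding Metric_space.MCauchy_def[OF Metric_space_F_USCG] by blast
  have "H_end (\<sigma> n) (upper_limit \<sigma>) \<le> 2 * (2 * e)" if n: "N \<le> n" for n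
  proof (rule H_end_leI[OF USC])
    show "0 \<le> 2 * e" using e by simp
  next
    fix x assume x: "2 * e < \<sigma> n x"
    have "\<exists>y. dist x y < e \<and> \<sigma> n x - e < \<sigma> m y" if "N \<le> m" for m
      using H_end_lessD[OF USC(1) USC(1) N[OF n that], of x] by metis
    then have "\<forall>k. \<exists>y. dist x y < e \<and> \<sigma> n x - e < \<sigma> (N + k) y" by simp
    then obtain y where y: "\<And>k. dist x (y k) < e" "\<And>k. \<sigma> n x - e < \<sigma> (N + k) (y k)" by metis
    have "y k \<in> cut_union U e" for k
      using x y(2)[of k] e \<sigma>[of "N + k"]
      by (auto simp: cut_union_def alpha_cut_def intro!: bexI[of _ "\<sigma> (N + k)"])
    then have "range y \<subseteq> cut_union U e" by blast
    moreover have "relatively_compact_in euclidean (cut_union U e)" using cuts e by simp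
    ultimately obtain z \<rho> where z: "strict_mono \<rho>" "(y \<circ> \<rho>) \<longlonglongrightarrow> z"
      unfolding relatively_compact_in_euclidean_iff_subsequence by metis
    have "(\<lambda>k. dist x ((y \<circ> \<rho>) k)) \<longlonglongrightarrow> dist x z"
      using z(2) by (intro tendsto_dist tendsto_const)
    then have "dist x z \<le> e"
      using y(1) by (intro LIMSEQ_le_const2) (auto intro: less_imp_le)
    have "cluster_level \<sigma> z (\<sigma> n x - e)"
      unfolding cluster_level_def
    proof (intro allI impI)
      fix \<delta> :: real and K assume "0 < \<delta>"
      then have "\<forall>\<^sub>F k in sequentially. dist (y (\<rho> k)) z < \<delta>"
        using tendstoD[OF z(2)] by simp
      then obtain k where "K \<le> k" "dist (y (\<rho> k)) z < \<delta>"
        unfolding eventually_sequentially by (metis nle_le)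
      moreover have "K \<le> N + \<rho> k"
        using \<open>K \<le> k\<close> seq_suble[OF z(1), of k] by simp
      ultimately show "\<exists>m\<ge>K. \<exists>w. dist z w < \<delta> \<and> \<sigma> n x - e - \<delta> < \<sigma> m w"
        using y(2)[of "\<rho> k"] \<open>0 < \<delta>\<close>
        by (intro exI[of _ "N + \<rho> k"] conjI exI[of _ "y (\<rho> k)"]) (auto simp: dist_commute)
    qed
    then have "\<sigma> n x - e \<le> upper_limit \<sigma> z"
      using level[of "\<sigma> n x - e"] x e bounds[of n x] by auto
    then show "\<exists>y. dist x y \<le> 2 * e \<and> \<sigma> n x - 2 * e \<le> upper_limit \<sigma> y"
      using \<open>dist x z \<le> e\<close> e by (intro exI[of _ z]) auto
  next
    fix x
    have "cluster_level \<sigma> x (upper_limit \<sigma> x)" using level[OF range] by blast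
    then obtain m y where m: "N \<le> m" "dist x y < e" "upper_limit \<sigma> x - e < \<sigma> m y"
      using e(1) unfolding cluster_level_def by blast
    obtain z where "dist y z < e" "\<sigma> m y - e < \<sigma> n z"
      using H_end_lessD[OF USC(1) USC(1) N[OF m(1) n], of y] by metis
    then show "\<exists>z. dist x z \<le> 2 * e \<and> upper_limit \<sigma> x - 2 * e \<le> \<sigma> n z"
      using m dist_triangle[of x z y] by (intro exI[of _ z]) auto
  qed
  then show "\<exists>N. \<forall>n\<ge>N. norm (H_end (\<sigma> n) (upper_limit \<sigma>) - 0) < \<epsilon>"
    using e(3) by (intro exI[of _ N]) (force simp: H_end_nonneg)
qed

section \<open>The equivalence\<close>

lemma relatively_compact_if_relatively_compact_cuts:
  fixes U :: "('a::metric_space \<Rightarrow> real) set"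
  assumes U: "U \<subseteq> F_USCG"
    and cuts: "\<forall>\<alpha>\<in>{0<..1}. relatively_compact_in euclidean (cut_union U \<alpha>)"
  shows "relatively_compact_in (Metric_space.mtopology F_USCG H_end) U"
  unfolding Metric_space.relatively_compact_in_iff_subsequence[OF Metric_space_F_USCG]
proof (intro conjI allI impI)
  fix \<sigma> :: "nat \<Rightarrow> 'a \<Rightarrow> real" assume \<sigma>: "range \<sigma> \<subseteq> U"
  then obtain \<rho> where \<rho>: "strict_mono \<rho>" "Metric_space.MCauchy F_USCG H_end (\<sigma> \<circ> \<rho>)"
    using mtotally_bounded_if_relatively_compact_cuts[OF U cuts]
    unfolding Metric_space.mtotally_bounded_sequentially[OF Metric_space_F_USCG] by metis
  have in_U: "(\<sigma> \<circ> \<rho>) n \<in> U" for n using \<sigma> by auto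
  have "(\<lambda>n. H_end (\<sigma> (\<rho> n)) (upper_limit (\<sigma> \<circ> \<rho>))) \<longlonglongrightarrow> 0"
    using Cauchy_tendsto_upper_limit[OF U cuts in_U \<rho>(2)] by simp
  moreover have "upper_limit (\<sigma> \<circ> \<rho>) \<in> F_USCG"
    using U cuts in_U by (rule upper_limit_in_F_USCG)
  ultimately show "\<exists>l\<in>F_USCG. \<exists>\<rho>. strict_mono \<rho> \<and> (\<lambda>n. H_end (\<sigma> (\<rho> n)) l) \<longlonglongrightarrow> 0"
    using \<rho>(1) by blast
qed (rule U)

lemma relatively_compact_in_F_USCG_iff_F_USCG_max:
  fixes U :: "('a::metric_space \<Rightarrow> real) set"
  assumes r: "r \<in> {0..1}" and U: "U \<subseteq> F_USCG_max r"
  shows "relatively_compact_in (Metric_space.mtopology F_USCG H_end) U \<longleftrightarrow>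
    relatively_compact_in (Metric_space.mtopology (F_USCG_max r) H_end) U"
proof -
  have max: "l \<in> F_USCG_max r"
    if "range \<sigma> \<subseteq> U" "l \<in> F_USCG" "(\<lambda>n. H_end (\<sigma> (\<rho> n)) l) \<longlonglongrightarrow> 0"
    for \<sigma> :: "nat \<Rightarrow> 'a \<Rightarrow> real" and \<rho> :: "nat \<Rightarrow> nat" and l
    by (rule F_USCG_max_closed[OF that(2) r _ that(3)]) (use that(1) U in blast)
  have "U \<subseteq> F_USCG" using U F_USCG_max_subset by blast
  then show ?thesis
    unfolding Metric_space.relatively_compact_in_iff_subsequence[OF Metric_space_F_USCG]
      Metric_space.relatively_compact_in_iff_subsequence[OF Metric_space_F_USCG_max]
    using U F_USCG_max_subset[of r] max by (meson subsetD)
qed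

theorem corollary6p10:
  fixes U :: "('a::metric_space \<Rightarrow> real) set" and r :: real
  assumes "r \<in> {0..1}" and "U \<subseteq> F_USCG_max r"
  shows "(relatively_compact_in (Metric_space.mtopology F_USCG H_end) U
            \<longleftrightarrow> relatively_compact_in (Metric_space.mtopology (F_USCG_max r) H_end) U)
       \<and> (relatively_compact_in (Metric_space.mtopology (F_USCG_max r) H_end) U
            \<longleftrightarrow> (\<forall>\<alpha>\<in>{0<..1}. relatively_compact_in euclidean (cut_union U \<alpha>)))
       \<and> ((\<forall>\<alpha>\<in>{0<..1}. relatively_compact_in euclidean (cut_union U \<alpha>))
            \<longleftrightarrow> (\<forall>\<alpha>\<in>{0<..r}. relatively_compact_in euclidean (cut_union U \<alpha>)))"
proof -
  have U: "U \<subseteq> F_USCG" using assms(2) F_USCG_max_subset by blast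
  have i_ii: "relatively_compact_in (Metric_space.mtopology F_USCG H_end) U
      \<longleftrightarrow> relatively_compact_in (Metric_space.mtopology (F_USCG_max r) H_end) U"
    by (rule relatively_compact_in_F_USCG_iff_F_USCG_max[OF assms])
  have i_iii: "relatively_compact_in (Metric_space.mtopology F_USCG H_end) U
      \<longleftrightarrow> (\<forall>\<alpha>\<in>{0<..1}. relatively_compact_in euclidean (cut_union U \<alpha>))"
    using relatively_compact_cut_union[of U] relatively_compact_if_relatively_compact_cuts[OF U] by blast
  have "relatively_compact_in euclidean (cut_union U \<alpha>)" if "r < \<alpha>" for \<alpha>
  proof -
    have "alpha_cut u \<alpha> = {}" if "u \<in> U" for u
    proof -
      have "u \<in> F_USCG_max r" using that assms(2) by blast
      then have "u x < \<alpha>" for x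
        using \<open>r < \<alpha>\<close> by (auto simp: F_USCG_max_def intro: le_less_trans)
      then show ?thesis using assms(1) \<open>r < \<alpha>\<close> by (auto simp: alpha_cut_def not_le)
    qed
    then have "cut_union U \<alpha> = {}" by (simp add: cut_union_def)
    then show ?thesis by (simp add: relatively_compact_in_def)
  qed
  then have iii_iv: "(\<forall>\<alpha>\<in>{0<..1}. relatively_compact_in euclidean (cut_union U \<alpha>))
      \<longleftrightarrow> (\<forall>\<alpha>\<in>{0<..r}. relatively_compact_in euclidean (cut_union U \<alpha>))"
    using assms(1) by force
  show ?thesis using i_ii i_iii iii_iv by blast
qed

end
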